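(* Let $K$ be a field, let $A$ be a finite-dimensional central-simple $K$-algebra, and let $\sigma$ be an automorphism of $K$ of finite order. Then $\sigma$ extends to a ring automorphism of $A$ if and only if $A$ and ${}_{\sigma^{-1}}A$ are isomorphic as $K$-algebras. In fact, any $K$-algebra isomorphism ${}_{\sigma^{-1}}A\to A$ becomes an extension of $\sigma$ to an automorphism of $A$ after identifying ${}_{\sigma^{-1}}A$ as a ring with $A$.
   Context: A central-simple $K$-algebra has no proper two-sided ideals and has center $K$. The $K$-algebra ${}_{\sigma^{-1}}A$ is the ring $A$ with the $K$-action redefined as $\lambda\circ a:=\sigma^{-1}(\lambda)a$ for $\lambda\in K$, $a\in A$. An extension of $\sigma$ to $A$ is a ring automorphism of $A$ whose restriction to $K=Z(A)$ is $\sigma$. *)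

theory Defs
  imports "HOL-Algebra.Algebra"
begin

text \<open>
  The locale \<open>algebra\<close> of \<open>HOL-Algebra.Module\<close> only covers commutative algebras, so associative
  unital algebras are introduced here over the same record type \<open>module\<close>.
\<close>

locale assoc_algebra = module K A + A?: ring A for K (structure) and A (structure) +
  assumes smult_mult_left:
      "\<lbrakk>k \<in> carrier K; x \<in> carrier A; y \<in> carrier A\<rbrakk> \<Longrightarrow>
        (k \<odot>\<^bsub>A\<^esub> x) \<otimes>\<^bsub>A\<^esub> y = k \<odot>\<^bsub>A\<^esub> (x \<otimes>\<^bsub>A\<^esub> y)"
    and smult_mult_right:
      "\<lbrakk>k \<in> carrier K; x \<in> carrier A; y \<in> carrier A\<rbrakk> \<Longrightarrow>
        x \<otimes>\<^bsub>A\<^esub> (k \<odot>\<^bsub>A\<^esub> y) = k \<odot>\<^bsub>A\<^esub> (x \<otimes>\<^bsub>A\<^esub> y)"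

definition scalar :: "('k, 'a, 'm) module_scheme \<Rightarrow> 'k \<Rightarrow> 'a" where
  "scalar A k = k \<odot>\<^bsub>A\<^esub> \<one>\<^bsub>A\<^esub>"

definition ring_center :: "('a, 'm) ring_scheme \<Rightarrow> 'a set" where
  "ring_center A = {z \<in> carrier A. \<forall>x \<in> carrier A. z \<otimes>\<^bsub>A\<^esub> x = x \<otimes>\<^bsub>A\<^esub> z}"

text \<open>
  The base field is identified with the center along \<open>scalar A\<close>, which is injective because
  \<open>A\<close> is nonzero. The library's \<open>finite_dimension\<close> is relative to a subfield of the ring, and
  multiplication by \<open>scalar A k\<close> is the same as the action of \<open>k\<close>.
\<close>

locale fin_dim_central_simple_algebra = assoc_algebra K A + K: field K
  for K (structure) and A (structure) +
  assumes nonzero: "\<one>\<^bsub>A\<^esub> \<noteq> \<zero>\<^bsub>A\<^esub>"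
    and simple: "\<And>I. ideal I A \<Longrightarrow> I = {\<zero>\<^bsub>A\<^esub>} \<or> I = carrier A"
    and central: "ring_center A = scalar A ` carrier K"
    and fin_dim: "ring.finite_dimension A (scalar A ` carrier K) (carrier A)"

definition algebra_iso ::
  "('k, 'n) ring_scheme \<Rightarrow> ('k, 'a, 'm) module_scheme \<Rightarrow> ('k, 'b, 'l) module_scheme \<Rightarrow> ('a \<Rightarrow> 'b) set" where
  "algebra_iso K A B =
    {f \<in> ring_iso A B. \<forall>k \<in> carrier K. \<forall>x \<in> carrier A. f (k \<odot>\<^bsub>A\<^esub> x) = k \<odot>\<^bsub>B\<^esub> f x}"

definition algebras_isomorphic ::
  "('k, 'n) ring_scheme \<Rightarrow> ('k, 'a, 'm) module_scheme \<Rightarrow> ('k, 'b, 'l) module_scheme \<Rightarrow> bool" where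
  "algebras_isomorphic K A B \<longleftrightarrow> algebra_iso K A B \<noteq> {}"

definition finite_order_on :: "'a set \<Rightarrow> ('a \<Rightarrow> 'a) \<Rightarrow> bool" where
  "finite_order_on S f \<longleftrightarrow> (\<exists>n > 0. \<forall>x \<in> S. (f ^^ n) x = x)"

text \<open>
  The twisted algebra differs from \<open>A\<close> only in its scalar action; in particular it has the same
  underlying ring, so a map out of it is literally a map out of \<open>A\<close>.
\<close>

definition inv_twist ::
  "('k, 'n) ring_scheme \<Rightarrow> ('k \<Rightarrow> 'k) \<Rightarrow> ('k, 'a, 'm) module_scheme \<Rightarrow> ('k, 'a, 'm) module_scheme" where
  "inv_twist K \<sigma> A = A\<lparr>smult := \<lambda>k x. inv_into (carrier K) \<sigma> k \<odot>\<^bsub>A\<^esub> x\<rparr>"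

definition extends_to_automorphism ::
  "('k, 'n) ring_scheme \<Rightarrow> ('k, 'a, 'm) module_scheme \<Rightarrow> ('k \<Rightarrow> 'k) \<Rightarrow> ('a \<Rightarrow> 'a) \<Rightarrow> bool" where
  "extends_to_automorphism K A \<sigma> \<tau> \<longleftrightarrow>
    \<tau> \<in> ring_iso A A \<and> (\<forall>k \<in> carrier K. \<tau> (scalar A k) = scalar A (\<sigma> k))"

lemma (in assoc_algebra) inv_twist_assoc_algebra:
  assumes "\<phi> \<in> ring_iso K K"
  shows "assoc_algebra K (inv_twist K \<phi> A)"
proof -
  define s where "s = inv_into (carrier K) \<phi>"
  have iso: "s \<in> ring_iso K K"
    unfolding s_def using ring_iso_set_sym[OF R.ring_axioms assms] by simp
  have s: "s \<one>\<^bsub>K\<^esub> = \<one>\<^bsub>K\<^esub>"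
      "\<And>k. k \<in> carrier K \<Longrightarrow> s k \<in> carrier K"
      "\<And>k l. \<lbrakk>k \<in> carrier K; l \<in> carrier K\<rbrakk> \<Longrightarrow> s (k \<oplus>\<^bsub>K\<^esub> l) = s k \<oplus>\<^bsub>K\<^esub> s l"
      "\<And>k l. \<lbrakk>k \<in> carrier K; l \<in> carrier K\<rbrakk> \<Longrightarrow> s (k \<otimes>\<^bsub>K\<^esub> l) = s k \<otimes>\<^bsub>K\<^esub> s l"
    using iso by (auto simp: ring_iso_def ring_hom_def)
  let ?B = "inv_twist K \<phi> A"
  have B: "carrier ?B = carrier A" "monoid.mult ?B = monoid.mult A" "one ?B = one A" "ring.zero ?B = ring.zero A"
      "ring.add ?B = ring.add A" "smult ?B = (\<lambda>k x. s k \<odot>\<^bsub>A\<^esub> x)"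
    by (simp_all add: inv_twist_def s_def)
  have ring: "ring ?B"
    by (intro ringI abelian_groupI monoidI; simp only: B)
       (auto simp: M.add.m_ac A.m_assoc A.l_distr A.r_distr intro: M.add.l_inv_ex)
  have "module K ?B"
    by (intro moduleI R.is_cring ring.is_abelian_group[OF ring])
       (simp_all add: B s smult_l_distr smult_r_distr smult_assoc1)
  with ring show ?thesis
    by (intro assoc_algebra.intro assoc_algebra_axioms.intro)
       (simp_all add: B s smult_mult_left smult_mult_right)
qed

end

theory Submission
  imports Defs
begin

text \<open>The twist leaves the ring untouched, so for a ring automorphism \<open>f\<close> of
  \<open>A\<close> the only question is how \<open>f\<close> treats scalars. Linearity from the
  twist to \<open>A\<close> says f(\<sigma>^{-1}(k) x) = k f(x). At x = 1, with \<sigma>(k) in place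
  of k, this reads f(k 1) = \<sigma>(k) 1, which is the extension property; multiplicativity of
  \<open>f\<close> recovers the general case from it. Thus isomorphisms from the twist to
  \<open>A\<close> and extensions of \<sigma> are the same maps
  (\<open>algebra_iso_inv_twist_iff\<close>), and \<open>algebra_iso_sym\<close> makes the direction
  of the isomorphism immaterial.\<close>

lemma algebra_iso_sym:
  assumes "assoc_algebra K A" and f: "f \<in> algebra_iso K A B"
  shows "inv_into (carrier A) f \<in> algebra_iso K B A"
proof -
  interpret A: assoc_algebra K A by fact
  let ?g = "inv_into (carrier A) f"
  have iso: "f \<in> ring_iso A B" and bij: "bij_betw f (carrier A) (carrier B)"
    and smult: "\<And>k x. \<lbrakk>k \<in> carrier K; x \<in> carrier A\<rbrakk> \<Longrightarrow> f (k \<odot>\<^bsub>A\<^esub> x) = k \<odot>\<^bsub>B\<^esub> f x"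
    using f by (auto simp: algebra_iso_def ring_iso_def)
  have "?g (k \<odot>\<^bsub>B\<^esub> y) = k \<odot>\<^bsub>A\<^esub> ?g y" if k: "k \<in> carrier K" and y: "y \<in> carrier B" for k y
  proof -
    have gy: "?g y \<in> carrier A" "f (?g y) = y"
      using bij y by (auto simp: bij_betw_def inv_into_into f_inv_into_f)
    \<comment> \<open>Linearity of \<open>f\<close> at the preimage of \<open>y\<close>; applying
      \<open>?g\<close> to both sides then gives linearity of \<open>?g\<close>.\<close>
    then have "f (k \<odot>\<^bsub>A\<^esub> ?g y) = k \<odot>\<^bsub>B\<^esub> y"
      using smult[OF k] by simp
    moreover have "k \<odot>\<^bsub>A\<^esub> ?g y \<in> carrier A"
      using k gy by simp
    ultimately show ?thesis
      using bij by (metis bij_betw_inv_into_left)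
  qed
  then show ?thesis
    using ring_iso_set_sym[OF A.A.ring_axioms iso] by (simp add: algebra_iso_def)
qed

lemma ring_iso_inv_twist_left [simp]: "ring_iso (inv_twist K \<sigma> A) B = ring_iso A B"
  by (simp add: inv_twist_def ring_iso_def ring_hom_def)

text \<open>Scalars act as multiplication by the elements \<open>scalar A k\<close>, so a ring
  homomorphism is semilinear as soon as it is so on these elements.\<close>

lemma algebra_iso_inv_twist_iff:
  assumes "assoc_algebra K A" and \<sigma>: "\<sigma> \<in> ring_iso K K"
  shows "f \<in> algebra_iso K (inv_twist K \<sigma> A) A \<longleftrightarrow> extends_to_automorphism K A \<sigma> f"
proof -
  interpret assoc_algebra K A by fact
  let ?s = "inv_into (carrier K) \<sigma>"
  have bij: "bij_betw \<sigma> (carrier K) (carrier K)"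
    using \<sigma> by (simp add: ring_iso_def)
  have s: "?s k \<in> carrier K" "\<sigma> (?s k) = k" "\<sigma> k \<in> carrier K" "?s (\<sigma> k) = k"
    if "k \<in> carrier K" for k
    using bij that
    by (auto simp: bij_betw_inv_into_right bij_betw_inv_into_left
        intro: bij_betw_apply bij_betw_apply[OF bij_betw_inv_into])
  have "(\<forall>k \<in> carrier K. \<forall>x \<in> carrier A. f (?s k \<odot>\<^bsub>A\<^esub> x) = k \<odot>\<^bsub>A\<^esub> f x) \<longleftrightarrow>
      (\<forall>k \<in> carrier K. f (scalar A k) = scalar A (\<sigma> k))" (is "?lin \<longleftrightarrow> ?ext")
    if f: "f \<in> ring_iso A A"
  proof -
    have hom: "f \<in> ring_hom A A"
      using f by (simp add: ring_iso_def)
    note fc = ring_hom_closed[OF hom]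
    show ?thesis
    proof
      assume lin: ?lin
      show ?ext
      proof
        fix k assume k: "k \<in> carrier K"
        then show "f (scalar A k) = scalar A (\<sigma> k)"
          \<comment> \<open>The scalar \<sigma>(k) acts on the twist as \<open>k\<close> does on
            \<open>A\<close>, and \<open>f\<close> fixes the unit.\<close>
          using lin[rule_format, of "\<sigma> k" "\<one>\<^bsub>A\<^esub>"] s ring_hom_one[OF hom]
          by (simp add: scalar_def)
      qed
    next
      assume ext: ?ext
      show ?lin
      proof (intro ballI)
        fix k x assume k: "k \<in> carrier K" and x: "x \<in> carrier A"
        have "f (?s k \<odot>\<^bsub>A\<^esub> x) = f (scalar A (?s k) \<otimes>\<^bsub>A\<^esub> x)"
          using k x s by (simp add: scalar_def smult_mult_left)
        \<comment> \<open>\<open>f\<close> is multiplicative, and \<open>ext\<close> at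
          \<open>?s k\<close> turns its scalar into \<sigma>(\<sigma>^{-1}(k)) = k.\<close>
        also have "\<dots> = scalar A k \<otimes>\<^bsub>A\<^esub> f x"
          using k x s ext ring_hom_mult[OF hom] by (simp add: scalar_def)
        also have "\<dots> = k \<odot>\<^bsub>A\<^esub> f x"
          using k x fc by (simp add: scalar_def smult_mult_left)
        finally show "f (?s k \<odot>\<^bsub>A\<^esub> x) = k \<odot>\<^bsub>A\<^esub> f x" .
      qed
    qed
  qed
  then show ?thesis
    by (auto simp: algebra_iso_def extends_to_automorphism_def) (simp_all add: inv_twist_def)
qed

theorem mainTheorem5:
  fixes K :: "('k, 'n) ring_scheme" and A :: "('k, 'a, 'm) module_scheme"
    and \<sigma> :: "'k \<Rightarrow> 'k"
  assumes "field K"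
    and "fin_dim_central_simple_algebra K A"
    and "\<sigma> \<in> ring_iso K K"
    and "finite_order_on (carrier K) \<sigma>"
  shows "((\<exists>\<tau>. extends_to_automorphism K A \<sigma> \<tau>) \<longleftrightarrow>
            algebras_isomorphic K A (inv_twist K \<sigma> A)) \<and>
         (\<forall>f \<in> algebra_iso K (inv_twist K \<sigma> A) A. extends_to_automorphism K A \<sigma> f)"
proof -
  have A: "assoc_algebra K A"
    using assms(2) by (simp add: fin_dim_central_simple_algebra_def)
  \<comment> \<open>\<open>algebras_isomorphic\<close> asks for a map from \<open>A\<close> to the
    twist, extensions are maps the other way; inverting an isomorphism out of the twist needs the
    twist to be an algebra.\<close>
  have "assoc_algebra K (inv_twist K \<sigma> A)"
    using assoc_algebra.inv_twist_assoc_algebra[OF A assms(3)] .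
  then have "algebras_isomorphic K A (inv_twist K \<sigma> A) \<longleftrightarrow>
      (\<exists>\<tau>. \<tau> \<in> algebra_iso K (inv_twist K \<sigma> A) A)"
    using algebra_iso_sym[OF A] algebra_iso_sym[of K "inv_twist K \<sigma> A"]
    unfolding algebras_isomorphic_def by (metis ex_in_conv)
  then show ?thesis
    using algebra_iso_inv_twist_iff[OF A assms(3)] by simp
qed

end
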